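(* If $G$ is a connected bipartite graph, then $\gamma_{it}(G)$ is either $\gamma(G)$ or $\gamma(G)+1$.
   Context: All graphs are finite, simple and undirected. For a graph $G$, a set $S\subseteq V(G)$ is a dominating set if every vertex in $V(G)\setminus S$ is adjacent to a vertex of $S$; the domination number $\gamma(G)$ is the minimum cardinality of a dominating set of $G$. A maximum independent set is an independent set of cardinality equal to the independence number $\alpha(G)$; $\Omega(G)$ denotes the set of all maximum independent sets of $G$. A dominating set $S$ of $G$ is an independent transversal dominating set if $S\cap I\neq\emptyset$ for every $I\in\Omega(G)$. The independent transversal domination number $\gamma_{it}(G)$ is the minimum cardinality of an independent transversal dominating set of $G$. *)

theory Defs
  imports "Graph_Theory.Graph_Theory"
begin

text \<open>
  A finite simple undirected graph is a \<^locale>\<open>graph\<close> of the Graph\_Theory library, i.e. a finite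
  symmetric digraph without loops and parallel arcs; the vertices \<open>u\<close> and \<open>v\<close> are adjacent
  iff \<open>u \<rightarrow>\<^bsub>G\<^esub> v\<close>. The library's \<^const>\<open>Digraph_Component.connected\<close> requires a
  nonempty vertex set.
\<close>

definition bipartite :: "('a, 'b) pre_digraph \<Rightarrow> bool" where
  "bipartite G \<longleftrightarrow> (\<exists>X Y. verts G = X \<union> Y \<and> X \<inter> Y = {} \<and>
     (\<forall>u v. u \<rightarrow>\<^bsub>G\<^esub> v \<longrightarrow> (u \<in> X \<and> v \<in> Y) \<or> (u \<in> Y \<and> v \<in> X)))"

definition dominating_set :: "('a, 'b) pre_digraph \<Rightarrow> 'a set \<Rightarrow> bool" where
  "dominating_set G S \<longleftrightarrow> S \<subseteq> verts G \<and> (\<forall>v \<in> verts G - S. \<exists>u \<in> S. v \<rightarrow>\<^bsub>G\<^esub> u)"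

definition domination_number :: "('a, 'b) pre_digraph \<Rightarrow> nat" where
  "domination_number G = Min (card ` {S. dominating_set G S})"

definition independent_set :: "('a, 'b) pre_digraph \<Rightarrow> 'a set \<Rightarrow> bool" where
  "independent_set G I \<longleftrightarrow> I \<subseteq> verts G \<and> (\<forall>u \<in> I. \<forall>v \<in> I. \<not> u \<rightarrow>\<^bsub>G\<^esub> v)"

definition independence_number :: "('a, 'b) pre_digraph \<Rightarrow> nat" where
  "independence_number G = Max (card ` {I. independent_set G I})"

definition maximum_independent_sets :: "('a, 'b) pre_digraph \<Rightarrow> 'a set set" where
  "maximum_independent_sets G = {I. independent_set G I \<and> card I = independence_number G}"

definition independent_transversal_dominating_set :: "('a, 'b) pre_digraph \<Rightarrow> 'a set \<Rightarrow> bool" where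
  "independent_transversal_dominating_set G S \<longleftrightarrow>
     dominating_set G S \<and> (\<forall>I \<in> maximum_independent_sets G. S \<inter> I \<noteq> {})"

text \<open>
  The minimum is taken over a nonempty finite set whenever \<open>G\<close> is a nonempty finite graph, since
  then the whole vertex set is an independent transversal dominating set.
\<close>

definition independent_transversal_domination_number :: "('a, 'b) pre_digraph \<Rightarrow> nat" where
  "independent_transversal_domination_number G =
     Min (card ` {S. independent_transversal_dominating_set G S})"

end

theory Submission
  imports Defs
begin

text \<open>
  Adding one suitable vertex to any minimum dominating set makes it meet every maximum independent
  set. This works because, in a bipartite graph, every vertex \<open>s\<close> has a partner \<open>t\<close> such that each
  maximum independent set contains \<open>s\<close> or \<open>t\<close>; as the graph is nonempty, a minimum dominating set
  \<open>S\<close> has an element \<open>s\<close>, and \<open>insert t S\<close> is the required set.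

  The partner comes from the lattice structure of the maximum independent sets. Let \<open>X\<close>, \<open>Y\<close> be the
  two colour classes and \<open>I\<close>, \<open>J\<close> maximum independent sets. Taking the union of the \<open>X\<close>-parts of
  \<open>I\<close> and \<open>J\<close> and the intersection of their \<open>Y\<close>-parts gives again a maximum independent set
  (\<open>maximum_independent_join\<close>). If \<open>s \<in> X\<close>, the maximum independent sets that avoid \<open>s\<close> are closed
  under this operation, so one of them has a least \<open>Y\<close>-part \<open>B\<close>, which is contained in all of them.
  The set \<open>B\<close> is nonempty, since otherwise a maximum independent set would lie inside \<open>X - {s}\<close> and
  the independent set \<open>X\<close> would be larger. Any \<open>t \<in> B\<close> is a partner of \<open>s\<close>
  (\<open>transversal_partner\<close>).
\<close>

lemma finite_independent_sets:
  assumes "finite (verts G)"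
  shows "finite {I. independent_set G I}"
  by (rule finite_subset[of _ "Pow (verts G)"]) (auto simp: assms independent_set_def)

lemma card_le_independence_number:
  assumes "finite (verts G)" "independent_set G I"
  shows "card I \<le> independence_number G"
  unfolding independence_number_def
  using assms finite_independent_sets by (intro Max_ge) auto

lemma finite_dominating_sets:
  assumes "finite (verts G)"
  shows "finite {S. dominating_set G S}"
  by (rule finite_subset[of _ "Pow (verts G)"]) (auto simp: assms dominating_set_def)

text \<open>
  An edge has one end in \<open>X\<close> and the other in \<open>Y\<close>. If both ends are in the join, the end in \<open>Y\<close> lies
  in \<open>I\<close> and in \<open>J\<close>, and the end in \<open>X\<close> lies in one of them, which contradicts its independence; so
  the join is independent, and by symmetry so is the set with union and intersection exchanged. The
  cardinalities of these two sets add up to \<open>card I + card J\<close>, and neither exceeds the independence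
  number, so both attain it.
\<close>

lemma maximum_independent_join:
  assumes fin: "finite (verts G)"
    and V: "verts G = X \<union> Y" and disj: "X \<inter> Y = {}"
    and edge: "\<And>u v. u \<rightarrow>\<^bsub>G\<^esub> v \<Longrightarrow> (u \<in> X \<and> v \<in> Y) \<or> (u \<in> Y \<and> v \<in> X)"
    and I: "I \<in> maximum_independent_sets G" and J: "J \<in> maximum_independent_sets G"
  shows "(I \<union> J) \<inter> X \<union> I \<inter> J \<inter> Y \<in> maximum_independent_sets G"
proof -
  define K where "K = (I \<union> J) \<inter> X \<union> I \<inter> J \<inter> Y"
  define L where "L = I \<inter> J \<inter> X \<union> (I \<union> J) \<inter> Y"
  have ind: "independent_set G I" "independent_set G J"
    and cards: "card I = independence_number G" "card J = independence_number G"
    using I J by (auto simp: maximum_independent_sets_def)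
  have sub: "I \<subseteq> X \<union> Y" "J \<subseteq> X \<union> Y"
    and indI: "\<And>u v. u \<in> I \<Longrightarrow> v \<in> I \<Longrightarrow> \<not> u \<rightarrow>\<^bsub>G\<^esub> v"
    and indJ: "\<And>u v. u \<in> J \<Longrightarrow> v \<in> J \<Longrightarrow> \<not> u \<rightarrow>\<^bsub>G\<^esub> v"
    using ind V by (auto simp: independent_set_def)
  have finIJ: "finite I" "finite J"
    using sub fin V by (auto intro: finite_subset)
  have "\<not> u \<rightarrow>\<^bsub>G\<^esub> v" if "u \<in> K" "v \<in> K" for u v
    using that edge[of u v] indI[of u v] indJ[of u v] disj unfolding K_def by blast
  then have K: "independent_set G K"
    using V by (auto simp: independent_set_def K_def)
  have "\<not> u \<rightarrow>\<^bsub>G\<^esub> v" if "u \<in> L" "v \<in> L" for u v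
    using that edge[of u v] indI[of u v] indJ[of u v] disj unfolding L_def by blast
  then have L: "independent_set G L"
    using V by (auto simp: independent_set_def L_def)
  have "K \<union> L = I \<union> J" "K \<inter> L = I \<inter> J"
    using sub disj unfolding K_def L_def by blast+
  moreover have "finite K" "finite L"
    using finIJ by (auto simp: K_def L_def)
  ultimately have "card K + card L = card I + card J"
    using card_Un_Int[of K L] card_Un_Int[of I J] finIJ by simp
  with card_le_independence_number[OF fin K] card_le_independence_number[OF fin L] cards
  have "card K = independence_number G" by linarith
  with K show ?thesis
    by (simp add: maximum_independent_sets_def K_def)
qed

lemma transversal_partner_in_class:
  assumes fin: "finite (verts G)"
    and V: "verts G = X \<union> Y" and disj: "X \<inter> Y = {}"
    and edge: "\<And>u v. u \<rightarrow>\<^bsub>G\<^esub> v \<Longrightarrow> (u \<in> X \<and> v \<in> Y) \<or> (u \<in> Y \<and> v \<in> X)"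
    and s: "s \<in> X"
  shows "\<exists>t \<in> verts G. \<forall>I \<in> maximum_independent_sets G. s \<in> I \<or> t \<in> I"
proof (cases "\<exists>I. I \<in> maximum_independent_sets G \<and> s \<notin> I")
  case True
  \<comment> \<open>Minimising the cardinality of the \<open>Y\<close>-part yields the least \<open>Y\<close>-part, by closure under joins.\<close>
  then obtain I where I: "I \<in> maximum_independent_sets G" "s \<notin> I"
    and least: "\<And>J. J \<in> maximum_independent_sets G \<Longrightarrow> s \<notin> J \<Longrightarrow> card (I \<inter> Y) \<le> card (J \<inter> Y)"
    using ex_has_least_nat[of "\<lambda>I. I \<in> maximum_independent_sets G \<and> s \<notin> I" _ "\<lambda>I. card (I \<inter> Y)"]
    by blast
  have subI: "I \<subseteq> X \<union> Y" and cardI: "card I = independence_number G"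
    using I V by (auto simp: maximum_independent_sets_def independent_set_def)
  have finXY: "finite X" "finite Y" using fin V by auto
  have "I \<inter> Y \<noteq> {}"
  proof
    assume "I \<inter> Y = {}"
    then have "I \<subset> X" using subI s I(2) by blast
    then have "card I < card X" using finXY by (simp add: psubset_card_mono)
    moreover have "independent_set G X"
      using V disj edge unfolding independent_set_def by blast
    ultimately show False
      using card_le_independence_number[OF fin] cardI by fastforce
  qed
  then obtain t where t: "t \<in> I \<inter> Y" by blast
  have "t \<in> J" if J: "J \<in> maximum_independent_sets G" "s \<notin> J" for J
  proof -
    let ?K = "(I \<union> J) \<inter> X \<union> I \<inter> J \<inter> Y"
    have "?K \<in> maximum_independent_sets G"
      by (rule maximum_independent_join[OF fin V disj _ I(1) J(1)]) (rule edge)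
    moreover have "s \<notin> ?K" using I(2) J(2) by blast
    moreover have "?K \<inter> Y = I \<inter> Y \<inter> J" using disj by blast
    ultimately have "card (I \<inter> Y) \<le> card (I \<inter> Y \<inter> J)" using least by metis
    then have "I \<inter> Y \<inter> J = I \<inter> Y"
      using finXY by (intro card_seteq) auto
    with t show ?thesis by blast
  qed
  with t V show ?thesis by blast
next
  case False
  with s V show ?thesis by blast
qed

lemma transversal_partner:
  assumes "finite (verts G)" "bipartite G" "s \<in> verts G"
  shows "\<exists>t \<in> verts G. \<forall>I \<in> maximum_independent_sets G. s \<in> I \<or> t \<in> I"
proof -
  obtain X Y where XY: "verts G = X \<union> Y" "X \<inter> Y = {}"
    and edge: "\<And>u v. u \<rightarrow>\<^bsub>G\<^esub> v \<Longrightarrow> (u \<in> X \<and> v \<in> Y) \<or> (u \<in> Y \<and> v \<in> X)"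
    using assms(2) unfolding bipartite_def by metis
  have YX: "verts G = Y \<union> X" "Y \<inter> X = {}" using XY by auto
  from assms(3) XY(1) consider "s \<in> X" | "s \<in> Y" by blast
  then show ?thesis
  proof cases
    case 1
    show ?thesis
      by (rule transversal_partner_in_class[OF assms(1) XY _ 1]) (rule edge)
  next
    case 2
    have "(u \<in> Y \<and> v \<in> X) \<or> (u \<in> X \<and> v \<in> Y)" if "u \<rightarrow>\<^bsub>G\<^esub> v" for u v
      using edge[OF that] by blast
    then show ?thesis
      by (rule transversal_partner_in_class[OF assms(1) YX _ 2])
  qed
qed

theorem theorem2p6:
  fixes G :: "('a, 'b) pre_digraph"
  assumes "graph G"
    and "Digraph_Component.connected G"
    and "bipartite G"
  shows "independent_transversal_domination_number G = domination_number G \<or>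
    independent_transversal_domination_number G = domination_number G + 1"
proof -
  interpret graph G by fact
  have fin: "finite (verts G)" by simp
  have nonempty: "verts G \<noteq> {}"
    using assms(2) by (auto simp: connected_def strongly_connected_def)
  let ?D = "{S. dominating_set G S}"
  let ?T = "{S. independent_transversal_dominating_set G S}"
  have TD: "?T \<subseteq> ?D" by (auto simp: independent_transversal_dominating_set_def)
  have finD: "finite ?D" by (rule finite_dominating_sets[OF fin])
  with TD have finT: "finite ?T" by (rule finite_subset)
  have "verts G \<in> ?D" by (simp add: dominating_set_def)
  then have "Min (card ` ?D) \<in> card ` ?D" using finD by (intro Min_in) auto
  then obtain S where S: "dominating_set G S" "card S = domination_number G"
    unfolding domination_number_def by auto
  have "S \<noteq> {}" using S(1) nonempty by (auto simp: dominating_set_def)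
  then obtain s where s: "s \<in> S" by blast
  have "s \<in> verts G" using s S(1) by (auto simp: dominating_set_def)
  from transversal_partner[OF fin assms(3) this] obtain t
    where t: "t \<in> verts G" "\<forall>I \<in> maximum_independent_sets G. s \<in> I \<or> t \<in> I" by blast
  have "dominating_set G (insert t S)"
    using S(1) t(1) by (auto simp: dominating_set_def)
  then have ins: "insert t S \<in> ?T"
    using s t(2) by (auto simp: independent_transversal_dominating_set_def)
  then have "independent_transversal_domination_number G \<le> card (insert t S)"
    unfolding independent_transversal_domination_number_def using finT by (intro Min_le) auto
  also have "\<dots> \<le> domination_number G + 1"
    using card_insert_le_m1[of "Suc (card S)" S t] S(2) by simp
  finally have "independent_transversal_domination_number G \<le> domination_number G + 1" .
  moreover have "domination_number G \<le> independent_transversal_domination_number G"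
    unfolding domination_number_def independent_transversal_domination_number_def
    using TD ins finD by (intro Min_antimono) auto
  ultimately show ?thesis by linarith
qed

end
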